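(* Let $\widehat{\mathcal{T}}=(\mathbb{Z}^+)^{\infty}$ be the set of all infinite sequences $\mathbf{k}=(k_1,k_2,\ldots)$ of positive integers. The map \[ \eta_{-1}:\widehat{\mathcal{T}}\to\left[\tfrac12,1\right),\qquad \mathbf{k}\mapsto\lim_{r\to+\infty}\ \sum_{n_1\geq\cdots\geq n_r\geq 1}\frac{(-1)^{n_1-1}}{n_1^{k_1}\cdots n_r^{k_r}} \] is (well defined and) bijective.
   Context: The inner multiple sums are understood as limits of partial sums with respect to the outer variable $n_1$: for each $n_1$ one first sums over the finitely many $n_1\ge n_2\ge\cdots\ge n_r\ge1$, and then one sums over $n_1=1,2,3,\ldots$ (this convention matters only when $k_1=1$, where convergence is conditional). *)

theory Defs
  imports Complex_Main "HOL-Library.FuncSet"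
begin

text \<open>Sequences are indexed from \<open>0\<close>: the entry \<open>k i\<close> is $k_{i+1}$, and likewise \<open>n i\<close> is $n_{i+1}$.\<close>

definition That :: "(nat \<Rightarrow> nat) set" where
  "That = {k. \<forall>i. 1 \<le> k i}"

text \<open>The tuples $n_1 \ge \cdots \ge n_r \ge 1$ with $n_1 = m$ (for $r \ge 1$). The upper bound
  \<open>m\<close> on the entries is implied by the other conditions; it makes finiteness evident.\<close>

definition chains :: "nat \<Rightarrow> nat \<Rightarrow> (nat \<Rightarrow> nat) set" where
  "chains r m = {n \<in> {..<r} \<rightarrow>\<^sub>E {1..m}. n 0 = m \<and> antimono_on {..<r} n}"

definition inner_sum :: "(nat \<Rightarrow> nat) \<Rightarrow> nat \<Rightarrow> nat \<Rightarrow> real" where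
  "inner_sum k r m = (\<Sum>n\<in>chains r m. (-1) ^ (n 0 - 1) / (\<Prod>i<r. real (n i) ^ k i))"

text \<open>The outer summation variable $n_1$ runs over $1, 2, 3, \ldots$, whence the shift by \<open>Suc\<close>;
  \<^const>\<open>suminf\<close> is the limit of the partial sums in this order (convergence may be conditional).\<close>

definition multiple_sum :: "(nat \<Rightarrow> nat) \<Rightarrow> nat \<Rightarrow> real" where
  "multiple_sum k r = (\<Sum>m. inner_sum k r (Suc m))"

definition eta_minus_one :: "(nat \<Rightarrow> nat) \<Rightarrow> real" where
  "eta_minus_one k = lim (\<lambda>r. multiple_sum k r)"

end

theory Submission
  imports Defs "HOL-Analysis.Equivalence_Lebesgue_Henstock_Integration"
begin

text \<open>Multiplying the series by powers of a variable \<open>x\<close> turns the sums into functions on \<open>[0, 1]\<close>: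
  for fixed \<open>k\<close> and \<open>r\<close>, the function $h(x) = \sum_{n_1} (-1)^{n_1-1} a_{n_1} x^{n_1-1}$ arises from the constant \<open>1\<close>
  by operators $h \mapsto \int_0^1 h(xs)\,ds$ (dividing $a_n$ by $n$) and $h \mapsto h / (1 + x)$
  (replacing $a_n$ by $\sum_{j \le n} a_j$). Prepending an entry $k$ applies the second operator once and
  then the first one $k$ times; call this $S_k$. All $S_k$ are strictly monotone and at least halve the
  distance between functions \<open>f\<close>, \<open>g\<close> with $|f(x) - g(x)| \le c x$.

  The functions \<open>1\<close> and \<open>1 / (1 + x)\<close> are the values of the entries $(\infty)$ and $(1, 1, 1, \ldots)$.
  With $A$ the first operator, $S_k$ maps them to $A^k (1/(1+x))$ and $A^{k-1} (1/(1+x))$, so the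
  intervals $[S_k (1/(1+x)), S_k(1))$, $k \ge 1$, are consecutive and fill $[1/(1+x), 1)$. Iterating
  and evaluating at \<open>x = 1\<close>, each finite sequence gets a half-open interval, the intervals of its
  one-entry extensions partition it, and the lengths tend to \<open>0\<close>: as for digit expansions, infinite
  sequences correspond bijectively to points of $[1/2, 1)$, in lexicographic order.\<close>

section \<open>Averaging and damping operators on continuous functions on [0, 1]\<close>

definition avg :: "(real \<Rightarrow> real) \<Rightarrow> real \<Rightarrow> real" where
  "avg h x = integral {0..1} (\<lambda>s. h (x * s))"

definition damp :: "(real \<Rightarrow> real) \<Rightarrow> real \<Rightarrow> real" where
  "damp h x = h x / (1 + x)"

definition step :: "nat \<Rightarrow> (real \<Rightarrow> real) \<Rightarrow> real \<Rightarrow> real" where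
  "step k h = (avg ^^ k) (damp h)"

abbreviation steps :: "nat list \<Rightarrow> (real \<Rightarrow> real) \<Rightarrow> real \<Rightarrow> real" where
  "steps \<equiv> foldr step"

abbreviation cont01 :: "(real \<Rightarrow> real) \<Rightarrow> bool" where
  "cont01 \<equiv> continuous_on {0..1}"

lemma mult_unit_interval: "x \<in> {0..1} \<Longrightarrow> s \<in> {0..1} \<Longrightarrow> x * s \<in> {0..1::real}"
  by (auto simp: mult_le_one)

lemma cont01_scale: "cont01 h \<Longrightarrow> x \<in> {0..1} \<Longrightarrow> cont01 (\<lambda>s. h (x * s))"
  by (rule continuous_on_compose2[of "{0..1}" h]) (auto intro!: continuous_intros simp: mult_le_one)

lemma integrable_scale: "cont01 h \<Longrightarrow> x \<in> {0..1} \<Longrightarrow> (\<lambda>s. h (x * s)) integrable_on {0..1}"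
  by (intro integrable_continuous_real cont01_scale)

lemma cont01_avg:
  assumes "cont01 h"
  shows "cont01 (avg h)"
proof -
  have "continuous_on ({0..1} \<times> cbox 0 1) (\<lambda>(x, s). h (x * s))"
    unfolding case_prod_beta
    by (rule continuous_on_compose2[OF assms]) (auto intro!: continuous_intros simp: mult_le_one)
  from integral_continuous_on_param[OF this] show ?thesis
    by (simp add: avg_def[abs_def])
qed

lemma cont01_damp: "cont01 h \<Longrightarrow> cont01 (damp h)"
  unfolding damp_def[abs_def] by (intro continuous_intros) auto

lemma cont01_funpow_avg: "cont01 h \<Longrightarrow> cont01 ((avg ^^ k) h)"
  by (induction k) (auto intro: cont01_avg)

lemma cont01_step: "cont01 h \<Longrightarrow> cont01 (step k h)"
  unfolding step_def by (intro cont01_funpow_avg cont01_damp)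

lemma cont01_steps: "cont01 h \<Longrightarrow> cont01 (steps ks h)"
  by (induction ks) (auto intro: cont01_step)

lemma avg_mono:
  assumes "cont01 f" "cont01 g" "\<And>x. x \<in> {0..1} \<Longrightarrow> f x \<le> g x" "x \<in> {0..1}"
  shows "avg f x \<le> avg g x"
  unfolding avg_def using assms
  by (intro integral_le integrable_scale assms(3) mult_unit_interval) auto

text \<open>The point 0 is left out because \<open>avg f 0 = f 0\<close>, and the functions compared
  later, \<open>low\<close> and \<open>unit\<close>, agree at 0. For positive \<open>x\<close> the
  integrands differ strictly for all \<open>s\<close> in (0, 1), which suffices by
  continuity.\<close>

lemma avg_strict_mono:
  assumes "cont01 f" "cont01 g" "\<And>x. x \<in> {0<..1} \<Longrightarrow> f x < g x" "x \<in> {0<..1}"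
  shows "avg f x < avg g x"
  unfolding avg_def using assms(1,2,4)
  by (intro integral_less_real cont01_scale assms(3)) (auto simp: mult_le_one)

lemma avg_add: "cont01 f \<Longrightarrow> cont01 g \<Longrightarrow> x \<in> {0..1} \<Longrightarrow> avg (\<lambda>x. f x + g x) x = avg f x + avg g x"
  unfolding avg_def by (intro integral_add integrable_scale)

lemma avg_mult_left: "avg (\<lambda>x. c * f x) x = c * avg f x"
  unfolding avg_def by simp

lemma avg_power: "avg (\<lambda>x. x ^ m) x = x ^ m / (real m + 1)"
proof -
  have "((\<lambda>s. s ^ m) has_integral (1 ^ Suc m / (real m + 1) - 0 ^ Suc m / (real m + 1))) {0..1::real}"
    by (rule fundamental_theorem_of_calculus)
       (auto intro!: derivative_eq_intros simp: has_real_derivative_iff_has_vector_derivative[symmetric]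
        divide_simps simp del: power_Suc)
  hence "integral {0..1::real} (\<lambda>s. s ^ m) = 1 / (real m + 1)"
    by (simp add: integral_unique)
  thus ?thesis
    by (simp add: avg_def power_mult_distrib)
qed

lemma avg_const [simp]: "avg (\<lambda>_. c) = (\<lambda>_. c)"
  by (rule ext) (simp add: avg_def)

lemma avg_abs_diff_le:
  assumes "cont01 f" "cont01 g" "cont01 d" "\<And>x. x \<in> {0..1} \<Longrightarrow> \<bar>f x - g x\<bar> \<le> d x" "x \<in> {0..1}"
  shows "\<bar>avg f x - avg g x\<bar> \<le> avg d x"
proof -
  have "avg f x \<le> avg (\<lambda>x. g x + d x) x"
    using assms(4) by (intro avg_mono continuous_intros assms) (fastforce simp: abs_le_iff)
  moreover have "avg g x \<le> avg (\<lambda>x. f x + d x) x"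
    using assms(4) by (intro avg_mono continuous_intros assms) (fastforce simp: abs_le_iff)
  ultimately show ?thesis
    using assms by (simp add: avg_add abs_le_iff)
qed

lemma funpow_avg_mono:
  assumes "cont01 f" "cont01 g" "\<And>x. x \<in> {0..1} \<Longrightarrow> f x \<le> g x" "x \<in> {0..1}"
  shows "(avg ^^ k) f x \<le> (avg ^^ k) g x"
  using assms(4)
proof (induction k arbitrary: x)
  case (Suc k)
  thus ?case by (auto intro!: avg_mono cont01_funpow_avg assms(1,2))
qed (use assms in auto)

lemma funpow_avg_strict_mono:
  assumes "cont01 f" "cont01 g" "\<And>x. x \<in> {0<..1} \<Longrightarrow> f x < g x" "x \<in> {0<..1}"
  shows "(avg ^^ k) f x < (avg ^^ k) g x"
  using assms(4)
proof (induction k arbitrary: x)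
  case (Suc k)
  thus ?case by (auto intro!: avg_strict_mono cont01_funpow_avg assms(1,2))
qed (use assms in auto)

lemma step_mono:
  assumes "cont01 f" "cont01 g" "\<And>x. x \<in> {0..1} \<Longrightarrow> f x \<le> g x" "x \<in> {0..1}"
  shows "step k f x \<le> step k g x"
  unfolding step_def using assms
  by (intro funpow_avg_mono cont01_damp) (auto simp: damp_def intro!: divide_right_mono)

lemma step_strict_mono:
  assumes "cont01 f" "cont01 g" "\<And>x. x \<in> {0<..1} \<Longrightarrow> f x < g x" "x \<in> {0<..1}"
  shows "step k f x < step k g x"
  unfolding step_def using assms
  by (intro funpow_avg_strict_mono cont01_damp) (auto simp: damp_def intro!: divide_strict_right_mono)

lemma steps_mono:
  assumes "cont01 f" "cont01 g" "\<And>x. x \<in> {0..1} \<Longrightarrow> f x \<le> g x" "x \<in> {0..1}"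
  shows "steps ks f x \<le> steps ks g x"
  using assms(4)
proof (induction ks arbitrary: x)
  case (Cons k ks)
  thus ?case by (auto intro!: step_mono cont01_steps assms(1,2))
qed (use assms in auto)

lemma steps_strict_mono:
  assumes "cont01 f" "cont01 g" "\<And>x. x \<in> {0<..1} \<Longrightarrow> f x < g x" "x \<in> {0<..1}"
  shows "steps ks f x < steps ks g x"
  using assms(4)
proof (induction ks arbitrary: x)
  case (Cons k ks)
  thus ?case by (auto intro!: step_strict_mono cont01_steps assms(1,2))
qed (use assms in auto)

text \<open>Identities such as \<open>step_low\<close> are proved on [0, 1] only, so they cannot
  simply be rewritten under \<open>steps\<close>; monotonicity in both directions carries them
  over.\<close>

lemma steps_cong:
  assumes "cont01 f" "cont01 g" "\<And>x. x \<in> {0..1} \<Longrightarrow> f x = g x" "x \<in> {0..1}"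
  shows "steps ks f x = steps ks g x"
  using steps_mono[of f g x ks] steps_mono[of g f x ks] assms by force

section \<open>The extremal functions \<open>unit\<close> and \<open>low\<close>\<close>

abbreviation unit :: "real \<Rightarrow> real" where
  "unit \<equiv> \<lambda>_. 1"

abbreviation low :: "real \<Rightarrow> real" where
  "low \<equiv> damp unit"

lemma cont01_unit: "cont01 unit"
  by (rule continuous_on_const)

lemma cont01_low: "cont01 low"
  by (intro cont01_damp cont01_unit)

text \<open>In \<open>s\<close>, the integrand 1 / (1 + x s)^2 has the antiderivative s / (1 + x s).
  Thus one averaging undoes one damping of \<open>low\<close>, and \<open>step 1\<close> fixes
  \<open>low\<close> on [0, 1].\<close>

lemma avg_damp_low:
  assumes "x \<in> {0..1}"
  shows "avg (damp low) x = low x"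
proof -
  have "((\<lambda>s. damp low (x * s)) has_integral (1 / (1 + x * 1) - 0 / (1 + x * 0))) {0..1}"
  proof (rule fundamental_theorem_of_calculus)
    fix s :: real assume "s \<in> {0..1}"
    with assms have "1 + x * s > 0"
      by (auto intro: add_pos_nonneg)
    thus "((\<lambda>s. s / (1 + x * s)) has_vector_derivative damp low (x * s)) (at s within {0..1})"
      unfolding has_real_derivative_iff_has_vector_derivative[symmetric] damp_def
      by (auto intro!: derivative_eq_intros simp: divide_simps)
  qed auto
  thus ?thesis
    by (simp add: avg_def integral_unique damp_def)
qed

text \<open>The innermost \<open>avg\<close> cancels the \<open>damp\<close>. As
  \<open>(avg ^^ k) low\<close> is also \<open>step k unit\<close>, the lower function for the entry
  \<open>Suc k\<close> is the upper one for \<open>k\<close>.\<close>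

lemma step_low:
  assumes "x \<in> {0..1}"
  shows "step (Suc k) low x = (avg ^^ k) low x"
  using funpow_avg_mono[of "avg (damp low)" low x k] funpow_avg_mono[of low "avg (damp low)" x k]
  using assms avg_damp_low
  by (force simp: step_def funpow_swap1 intro!: cont01_avg cont01_damp cont01_unit)

lemma low_less_unit: "x \<in> {0<..1} \<Longrightarrow> low x < unit x"
  by (simp add: damp_def)

lemma low_le_unit: "x \<in> {0..1} \<Longrightarrow> low x \<le> unit x"
  by (simp add: damp_def)

text \<open>On [0, 1], \<open>low\<close> is itself the average of \<open>damp low\<close>, which
  lies below \<open>low\<close>.\<close>

lemma low_le_avg_low: "x \<in> {0..1} \<Longrightarrow> low x \<le> avg low x"
  by (subst avg_damp_low[symmetric])
     (auto intro!: avg_mono cont01_damp cont01_unit simp: damp_def divide_simps)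

lemma funpow_avg_low_mono:
  assumes "j \<le> k" "x \<in> {0..1}"
  shows "(avg ^^ j) low x \<le> (avg ^^ k) low x"
  using assms(1)
proof (induction k rule: dec_induct)
  case (step k)
  have "(avg ^^ k) low x \<le> (avg ^^ k) (avg low) x"
    by (intro funpow_avg_mono low_le_avg_low assms cont01_avg cont01_low)
  with step show ?case
    by (simp add: funpow_swap1)
qed auto

lemma low_le_step_low: "1 \<le> k \<Longrightarrow> x \<in> {0..1} \<Longrightarrow> low x \<le> step k low x"
  using step_low[of x "k - 1"] funpow_avg_low_mono[of 0 "k - 1" x] by simp

lemma step_unit_less:
  assumes "x \<in> {0<..1}"
  shows "step k unit x < unit x"
proof -
  have "(avg ^^ k) low x < (avg ^^ k) unit x"
    by (rule funpow_avg_strict_mono[OF cont01_low cont01_unit low_less_unit assms])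
  moreover have "(avg ^^ k) unit = unit"
    by (induction k) auto
  ultimately show ?thesis
    by (simp add: step_def)
qed

section \<open>Contraction estimates\<close>

lemma avg_contract:
  assumes "cont01 f" "cont01 g" "\<And>x. x \<in> {0..1} \<Longrightarrow> \<bar>f x - g x\<bar> \<le> c * x" "x \<in> {0..1}"
  shows "\<bar>avg f x - avg g x\<bar> \<le> c / 2 * x"
proof -
  have "\<bar>avg f x - avg g x\<bar> \<le> avg (\<lambda>x. c * x ^ 1) x"
    using assms by (intro avg_abs_diff_le) (auto intro!: continuous_intros)
  also have "\<dots> = c / 2 * x"
    by (subst avg_mult_left, subst avg_power) simp
  finally show ?thesis .
qed

lemma funpow_avg_contract:
  assumes "cont01 f" "cont01 g" "\<And>x. x \<in> {0..1} \<Longrightarrow> \<bar>f x - g x\<bar> \<le> c * x" "x \<in> {0..1}"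
  shows "\<bar>(avg ^^ k) f x - (avg ^^ k) g x\<bar> \<le> c / 2 ^ k * x"
  using assms(4)
proof (induction k arbitrary: x)
  case (Suc k)
  have "\<bar>avg ((avg ^^ k) f) x - avg ((avg ^^ k) g) x\<bar> \<le> c / 2 ^ k / 2 * x"
    using Suc by (intro avg_contract cont01_funpow_avg assms)
  thus ?case
    by (simp add: field_simps)
qed (use assms in auto)

lemma damp_abs_diff_le:
  assumes "x \<in> {0..1}"
  shows "\<bar>damp f x - damp g x\<bar> \<le> \<bar>f x - g x\<bar>"
proof -
  have "\<bar>damp f x - damp g x\<bar> = \<bar>f x - g x\<bar> / (1 + x)"
    using assms by (simp add: damp_def diff_divide_distrib[symmetric] abs_divide)
  also have "\<dots> \<le> \<bar>f x - g x\<bar> / 1"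
    using assms by (intro divide_left_mono) auto
  finally show ?thesis by simp
qed

text \<open>Each entry is at least 1 and so brings at least one \<open>avg\<close>, while
  \<open>damp\<close> does not enlarge differences. The bounds are proportional to \<open>x\<close>
  because averaging halves \<open>c * x\<close>, whereas it reproduces a constant bound
  unchanged.\<close>

lemma steps_contract:
  assumes "\<forall>k\<in>set ks. 1 \<le> k" "cont01 f" "cont01 g"
    and "\<And>x. x \<in> {0..1} \<Longrightarrow> \<bar>f x - g x\<bar> \<le> c * x" "0 \<le> c" "x \<in> {0..1}"
  shows "\<bar>steps ks f x - steps ks g x\<bar> \<le> c / 2 ^ length ks * x"
  using assms(1,6)
proof (induction ks arbitrary: x)
  case (Cons k ks)
  let ?c = "c / 2 ^ length ks"
  have "\<bar>damp (steps ks f) x - damp (steps ks g) x\<bar> \<le> ?c * x" if "x \<in> {0..1}" for x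
    using damp_abs_diff_le[OF that] Cons that by (meson list.set_intros(2) order_trans)
  hence "\<bar>(avg ^^ k) (damp (steps ks f)) x - (avg ^^ k) (damp (steps ks g)) x\<bar> \<le> ?c / 2 ^ k * x"
    using Cons.prems by (intro funpow_avg_contract cont01_damp cont01_steps assms) auto
  also have "\<dots> \<le> ?c / 2 ^ 1 * x"
    using Cons.prems \<open>0 \<le> c\<close>
    by (intro mult_right_mono divide_left_mono power_increasing) auto
  finally show ?case
    by (simp add: step_def[of k] field_simps)
qed (use assms in auto)

lemma abs_unit_diff_low_le: "x \<in> {0..1} \<Longrightarrow> \<bar>unit x - low x\<bar> \<le> 1 * x"
  by (auto simp: damp_def divide_simps abs_if algebra_simps)

section \<open>Intervals of finite sequences and their one-entry extensions\<close>

lemma steps_append_unit_less: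
  "x \<in> {0<..1} \<Longrightarrow> steps (ks @ [k]) unit x < steps ks unit x"
  using steps_strict_mono[OF cont01_step[OF cont01_unit] cont01_unit step_unit_less] by simp

lemma steps_append_low_ge:
  "1 \<le> k \<Longrightarrow> x \<in> {0..1} \<Longrightarrow> steps ks low x \<le> steps (ks @ [k]) low x"
  using steps_mono[OF cont01_low cont01_step[OF cont01_low] low_le_step_low] by simp

text \<open>With \<open>steps_append_low_eq\<close>, this shows that the intervals of
  \<open>ks @ [k]\<close> and \<open>ks @ [Suc k]\<close> are adjacent: both have the endpoint
  \<open>steps ks ((avg ^^ k) low) 1\<close>.\<close>

lemma steps_append_unit_eq: "steps (ks @ [k]) unit = steps ks ((avg ^^ k) low)"
  by (simp add: step_def)

lemma steps_append_low_eq: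
  "x \<in> {0..1} \<Longrightarrow> steps (ks @ [Suc k]) low x = steps ks ((avg ^^ k) low) x"
  using steps_cong[OF cont01_step[OF cont01_low] cont01_funpow_avg[OF cont01_low] step_low] by simp

text \<open>The adjacent intervals exhaust that of \<open>ks\<close> towards its right end:
  \<open>unit\<close> is fixed by \<open>avg\<close>, so the contraction brings
  \<open>(avg ^^ k) low\<close> within \<open>1 / 2 ^ k\<close> of it.\<close>

lemma steps_append_unit_tendsto:
  assumes "\<forall>k\<in>set ks. 1 \<le> k"
  shows "(\<lambda>k. steps (ks @ [k]) unit 1) \<longlonglongrightarrow> steps ks unit 1"
proof -
  have 1: "(avg ^^ k) unit = unit" for k
    by (induction k) auto
  have "\<bar>unit x - (avg ^^ k) low x\<bar> \<le> 1 / 2 ^ k * x" if "x \<in> {0..1}" for k x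
    using funpow_avg_contract[OF cont01_unit cont01_low abs_unit_diff_low_le that, of k]
    by (simp only: 1)
  hence "\<bar>steps ks unit 1 - steps ks ((avg ^^ k) low) 1\<bar> \<le> 1 / 2 ^ k / 2 ^ length ks * 1" for k
    using assms by (intro steps_contract cont01_unit cont01_low cont01_funpow_avg) auto
  also have "1 / 2 ^ k / 2 ^ length ks * 1 \<le> (1 / 2 :: real) ^ k" for k
    by (simp add: field_simps)
  finally have "norm (steps (ks @ [k]) unit 1 - steps ks unit 1) \<le> (1 / 2) ^ k" for k
    by (simp add: steps_append_unit_eq abs_minus_commute del: foldr_append)
  hence "(\<lambda>k. steps (ks @ [k]) unit 1 - steps ks unit 1) \<longlonglongrightarrow> 0"
    by (intro Lim_null_comparison[OF always_eventually LIMSEQ_power_zero[of "1 / 2"]]) auto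
  thus ?thesis
    by (simp add: LIM_zero_iff)
qed

section \<open>The value of an infinite sequence and its lexicographic monotonicity\<close>

definition prefix :: "(nat \<Rightarrow> nat) \<Rightarrow> nat \<Rightarrow> nat list" where
  "prefix k r = map k [0..<r]"

lemma prefix_0 [simp]: "prefix k 0 = []"
  by (simp add: prefix_def)

lemma prefix_Suc: "prefix k (Suc r) = prefix k r @ [k r]"
  by (simp add: prefix_def)

lemma length_prefix [simp]: "length (prefix k r) = r"
  by (simp add: prefix_def)

lemma prefix_pos: "k \<in> That \<Longrightarrow> \<forall>a\<in>set (prefix k r). 1 \<le> a"
  by (auto simp: prefix_def That_def)

lemma decseq_upper: "decseq (\<lambda>r. steps (prefix k r) unit 1)"
  by (intro decseq_SucI) (auto simp: prefix_Suc less_imp_le steps_append_unit_less simp del: foldr_append)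

lemma incseq_lower: "k \<in> That \<Longrightarrow> incseq (\<lambda>r. steps (prefix k r) low 1)"
  by (intro incseq_SucI) (auto simp: prefix_Suc That_def steps_append_low_ge simp del: foldr_append)

lemma lower_le_upper: "steps ks low 1 \<le> steps ks unit 1"
  by (intro steps_mono cont01_low cont01_unit low_le_unit) auto

lemma lower_le_upper_cross:
  assumes "k \<in> That"
  shows "steps (prefix k r) low 1 \<le> steps (prefix k s) unit 1"
proof -
  have "steps (prefix k r) low 1 \<le> steps (prefix k (max r s)) low 1"
    using incseq_lower[OF assms] by (auto simp: incseq_def)
  also have "\<dots> \<le> steps (prefix k (max r s)) unit 1"
    by (rule lower_le_upper)
  also have "\<dots> \<le> steps (prefix k s) unit 1"
    using decseq_upper[of k] by (auto simp: decseq_def)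
  finally show ?thesis .
qed

lemma upper_minus_lower:
  assumes "\<forall>k\<in>set ks. 1 \<le> k"
  shows "\<bar>steps ks unit 1 - steps ks low 1\<bar> \<le> (1 / 2) ^ length ks"
  using steps_contract[OF assms cont01_unit cont01_low abs_unit_diff_low_le, of 1]
  by (simp add: power_one_over)

text \<open>Upper ends are used because for \<open>r \<ge> 1\<close> they are exactly the multiple
  sums; see \<open>inner_sum_sums\<close>.\<close>

definition val :: "(nat \<Rightarrow> nat) \<Rightarrow> real" where
  "val k = lim (\<lambda>r. steps (prefix k r) unit 1)"

lemma tendsto_val:
  assumes "k \<in> That"
  shows "(\<lambda>r. steps (prefix k r) unit 1) \<longlonglongrightarrow> val k"
  using decseq_convergent[OF decseq_upper, of "steps (prefix k 0) low 1" k] lower_le_upper_cross[OF assms, of 0]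
  unfolding val_def by (metis convergentI convergent_LIMSEQ_iff)

lemma lower_le_val: "k \<in> That \<Longrightarrow> steps (prefix k r) low 1 \<le> val k"
  by (rule LIMSEQ_le_const[OF tendsto_val]) (auto intro: lower_le_upper_cross)

text \<open>The next upper end is already strictly smaller; this is why right endpoints are never
  attained.\<close>

lemma val_less_upper:
  assumes "k \<in> That"
  shows "val k < steps (prefix k r) unit 1"
proof -
  have "val k \<le> steps (prefix k (Suc r)) unit 1"
    by (rule decseq_ge[OF decseq_upper tendsto_val[OF assms]])
  also have "\<dots> < steps (prefix k r) unit 1"
    by (simp add: prefix_Suc steps_append_unit_less del: foldr_append)
  finally show ?thesis .
qed

text \<open>At the first difference both sequences pass to one-entry extensions of the same prefix,
  and the interval of the smaller entry lies to the left.\<close>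

lemma val_less:
  assumes "k \<in> That" "k' \<in> That" "\<And>i. i < r \<Longrightarrow> k i = k' i" "k r < k' r"
  shows "val k < val k'"
proof -
  have prefix: "prefix k r = prefix k' r"
    using assms(3) by (simp add: prefix_def)
  have "val k < steps (prefix k (Suc r)) unit 1"
    by (rule val_less_upper) fact
  also have "\<dots> = steps (prefix k' r) ((avg ^^ k r) low) 1"
    by (simp only: prefix_Suc prefix steps_append_unit_eq)
  \<comment> \<open>Here \<open>k r \<le> k' r - 1\<close>, and the iterates of \<open>avg\<close>
    on \<open>low\<close> increase.\<close>
  also have "\<dots> \<le> steps (prefix k' r) ((avg ^^ (k' r - 1)) low) 1"
    using assms(4) by (intro steps_mono funpow_avg_low_mono cont01_funpow_avg cont01_low) auto
  also have "\<dots> = steps (prefix k' (Suc r)) low 1"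
    using steps_append_low_eq[of 1 "prefix k' r" "k' r - 1"] assms(4) by (simp add: prefix_Suc)
  also have "\<dots> \<le> val k'"
    by (rule lower_le_val) fact
  finally show ?thesis .
qed

lemma inj_on_val: "inj_on val That"
proof (rule inj_onI, rule ccontr)
  fix k k' assume *: "k \<in> That" "k' \<in> That" "val k = val k'" "k \<noteq> k'"
  hence "\<exists>r. k r \<noteq> k' r"
    by auto
  then obtain r where "k r \<noteq> k' r" "\<And>i. i < r \<Longrightarrow> k i = k' i"
    using exists_least_iff[of "\<lambda>r. k r \<noteq> k' r"] by auto
  thus False
    using val_less[of k k' r] val_less[of k' k r] * by (cases "k r" "k' r" rule: linorder_cases) auto
qed

section \<open>Surjectivity by successive choice of entries\<close>

lemma next_index:
  assumes "\<forall>k\<in>set ks. 1 \<le> k" "steps ks low 1 \<le> y" "y < steps ks unit 1"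
  shows "\<exists>k\<ge>1. steps (ks @ [k]) low 1 \<le> y \<and> y < steps (ks @ [k]) unit 1"
proof -
  let ?P = "\<lambda>k. y < steps (ks @ [k]) unit 1"
  have "\<exists>k. ?P k"
    using order_tendstoD(1)[OF steps_append_unit_tendsto[OF assms(1)] assms(3)]
    by (rule eventually_happens'[OF sequentially_bot])
  \<comment> \<open>By minimality \<open>y\<close> is at least the upper end for the preceding
    index, which is the lower end for this one.\<close>
  define k where "k = (LEAST k. ?P k)"
  have k: "?P k"
    unfolding k_def by (rule LeastI_ex) fact
  \<comment> \<open>For index 0 the upper end is the lower end of \<open>ks\<close> itself; hence
    \<open>k \<ge> 1\<close>.\<close>
  have "\<not> ?P 0"
    using assms(2) unfolding steps_append_unit_eq by simp
  with k obtain j where j: "k = Suc j"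
    by (cases k) auto
  have "\<not> ?P j"
    using not_less_Least[of j ?P] j unfolding k_def by simp
  hence "steps (ks @ [k]) low 1 \<le> y"
    unfolding j using steps_append_low_eq[of 1 ks j] steps_append_unit_eq[of ks j] by simp
  with k j show ?thesis
    by (intro exI[of _ k]) simp
qed

lemma val_surj:
  assumes "y \<in> {1/2..<1}"
  shows "\<exists>k\<in>That. val k = y"
proof -
  define P where "P r ks \<longleftrightarrow> length ks = r \<and> (\<forall>k\<in>set ks. 1 \<le> k) \<and>
    steps ks low 1 \<le> y \<and> y < steps ks unit 1" for r ks
  \<comment> \<open>Dependent choice makes each list extend the previous one, so that all are
    prefixes of a single sequence.\<close>
  have "\<exists>f. \<forall>r. P r (f r) \<and> (\<exists>j. f (Suc r) = f r @ [j])"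
  proof (rule dependent_nat_choice)
    show "\<exists>ks. P 0 ks"
      using assms by (intro exI[of _ "[]"]) (simp add: P_def damp_def)
    show "\<exists>ks'. P (Suc r) ks' \<and> (\<exists>j. ks' = ks @ [j])" if "P r ks" for ks r
    proof -
      have "\<exists>j\<ge>1. steps (ks @ [j]) low 1 \<le> y \<and> y < steps (ks @ [j]) unit 1"
        using that unfolding P_def by (intro next_index) auto
      then obtain j where "j \<ge> 1" "steps (ks @ [j]) low 1 \<le> y" "y < steps (ks @ [j]) unit 1"
        by blast
      hence "P (Suc r) (ks @ [j])"
        using that unfolding P_def by auto
      thus ?thesis by blast
    qed
  qed
  then obtain f where P: "\<And>r. P r (f r)" and "\<forall>r. \<exists>j. f (Suc r) = f r @ [j]"
    by blast
  then obtain k where k: "\<And>r. f (Suc r) = f r @ [k r]"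
    by metis
  have "f 0 = []"
    using P[of 0] by (simp add: P_def)
  hence f: "f r = prefix k r" for r
    by (induction r) (auto simp: prefix_Suc k)
  have "1 \<le> k r" for r
    using P[of "Suc r"] by (simp add: k P_def)
  hence That: "k \<in> That"
    by (simp add: That_def)
  \<comment> \<open>Both numbers lie in the closed interval of the prefix, whose length is at most
    \<open>(1 / 2) ^ r\<close>.\<close>
  have "norm (steps (prefix k r) unit 1 - y) \<le> (1 / 2) ^ r" for r
    using P[of r] upper_minus_lower[of "prefix k r"] unfolding P_def f by auto
  hence "(\<lambda>r. steps (prefix k r) unit 1 - y) \<longlonglongrightarrow> 0"
    by (intro Lim_null_comparison[OF always_eventually LIMSEQ_power_zero[of "1 / 2"]]) auto
  hence "val k = y"
    using tendsto_val[OF That] LIMSEQ_unique by (auto simp: LIM_zero_iff)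
  with That show ?thesis by blast
qed

lemma bij_betw_val: "bij_betw val That {1/2..<1}"
proof -
  \<comment> \<open>The empty prefix gives the bounds \<open>low 1\<close>, which is 1/2, and
    \<open>unit 1\<close>.\<close>
  have "val k \<in> {1/2..<1}" if "k \<in> That" for k
    using lower_le_val[OF that, of 0] val_less_upper[OF that, of 0] by (simp add: damp_def)
  thus ?thesis
    using inj_on_val val_surj unfolding bij_betw_def by blast
qed

section \<open>Unsigned coefficients and uniform convergence of the power series of
  \<open>steps ks unit\<close>\<close>

fun coeff :: "nat list \<Rightarrow> nat \<Rightarrow> real" where
  "coeff [] m = (if m = 0 then 1 else 0)"
| "coeff (k # ks) m = (\<Sum>j\<le>m. coeff ks j) / real (Suc m) ^ k"

definition psum :: "(nat \<Rightarrow> real) \<Rightarrow> nat \<Rightarrow> real \<Rightarrow> real" where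
  "psum c N x = (\<Sum>m<N. (-1) ^ m * c m * x ^ m)"

lemma cont01_psum: "cont01 (psum c N)"
  unfolding psum_def[abs_def] by (intro continuous_intros)

lemma avg_psum: "x \<in> {0..1} \<Longrightarrow> avg (psum c N) x = psum (\<lambda>m. c m / real (Suc m)) N x"
proof (induction N)
  case 0
  thus ?case by (simp add: psum_def avg_def)
next
  case (Suc N)
  have "avg (psum c (Suc N)) x = avg (\<lambda>x. psum c N x + (-1) ^ N * c N * x ^ N) x"
    by (simp add: psum_def[abs_def])
  also have "\<dots> = avg (psum c N) x + (-1) ^ N * c N * avg (\<lambda>x. x ^ N) x"
    using Suc.prems by (subst avg_add) (auto intro!: cont01_psum continuous_intros simp: avg_mult_left)
  finally show ?case
    using Suc.IH[OF Suc.prems]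
    by (simp only: avg_power) (simp add: psum_def add.commute[of 1])
qed

text \<open>The partial sums of the series of $h(x)/(1+x)$ need not converge at \<open>x = 1\<close>; the last summand
  is the error term, which only becomes small after averaging, by Cesaro's theorem.\<close>

lemma psum_eq_partial_sums:
  "psum c N x = (1 + x) * psum (\<lambda>m. \<Sum>j\<le>m. c j) N x + (-1) ^ N * (\<Sum>j<N. c j) * x ^ N"
proof (induction N)
  case (Suc N)
  thus ?case
    by (simp add: psum_def lessThan_Suc_atMost[symmetric] algebra_simps)
qed (simp add: psum_def)

text \<open>Beyond \<open>M\<close> each term is below \<open>e / 2\<close>; the first
  \<open>M\<close> terms contribute at most the fixed amount \<open>S\<close>, which is less than
  \<open>e / 2 * N\<close> once \<open>N\<close> exceeds \<open>2 * S / e\<close>.\<close>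

lemma cesaro_null:
  fixes c :: "nat \<Rightarrow> real"
  assumes "c \<longlonglongrightarrow> 0"
  shows "(\<lambda>N. (\<Sum>j<N. c j) / (real N + 1)) \<longlonglongrightarrow> 0"
proof (rule LIMSEQ_I)
  fix e :: real assume "0 < e"
  then obtain M where M: "\<And>n. n \<ge> M \<Longrightarrow> \<bar>c n\<bar> < e / 2"
    using LIMSEQ_D[OF assms, of "e / 2"] by auto
  define S where "S = (\<Sum>j<M. \<bar>c j\<bar>)"
  have bound: "(\<Sum>j<N. \<bar>c j\<bar>) \<le> S + e / 2 * real N" if "N \<ge> M" for N
    using that
  proof (induction N rule: dec_induct)
    case base
    thus ?case using \<open>0 < e\<close> by (simp add: S_def)
  next
    case (step N)
    thus ?case using M[of N] by (simp add: field_simps)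
  qed
  obtain K where K: "real K > 2 * S / e"
    using reals_Archimedean2 by blast
  have "norm ((\<Sum>j<N. c j) / (real N + 1) - 0) < e" if "N \<ge> max M K" for N
  proof -
    have "\<bar>\<Sum>j<N. c j\<bar> \<le> S + e / 2 * real N"
      using bound[of N] sum_abs[of c "{..<N}"] that by linarith
    moreover have "2 * S / e < real N"
      using K that by simp
    hence "S < e / 2 * real N"
      using \<open>0 < e\<close> by (simp add: field_simps)
    ultimately have "\<bar>\<Sum>j<N. c j\<bar> < e * (real N + 1)"
      using \<open>0 < e\<close> by (simp add: algebra_simps)
    thus ?thesis
      by (simp add: divide_less_eq)
  qed
  thus "\<exists>n0. \<forall>N\<ge>n0. norm ((\<Sum>j<N. c j) / (real N + 1) - 0) < e"
    by blast
qed

text \<open>At x = 1 this is a convergent series, so its terms tend to 0, and the norm removes the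
  signs. It provides the hypothesis of \<open>cesaro_null\<close>.\<close>

lemma uniform_limit_imp_coeff_null:
  assumes "uniform_limit {0..1} (psum c) h sequentially"
  shows "c \<longlonglongrightarrow> 0"
proof -
  have "(\<lambda>N. psum c N 1) \<longlonglongrightarrow> h 1"
    using tendsto_uniform_limitI[OF assms, of 1] by simp
  hence "summable (\<lambda>m. (-1) ^ m * c m)"
    by (auto simp: psum_def summable_def sums_def)
  hence "(\<lambda>m. norm ((-1) ^ m * c m)) \<longlonglongrightarrow> 0"
    by (intro tendsto_norm_zero summable_LIMSEQ_zero)
  thus ?thesis
    by (simp add: abs_mult tendsto_rabs_zero_iff)
qed

lemma uniform_limit_avg:
  assumes "cont01 h" "uniform_limit {0..1} (psum c) h sequentially"
  shows "uniform_limit {0..1} (psum (\<lambda>m. c m / real (Suc m))) (avg h) sequentially"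
proof (rule uniform_limitI)
  fix e :: real assume "0 < e"
  have "\<forall>\<^sub>F N in sequentially. \<forall>x\<in>{0..1}. dist (psum c N x) (h x) < e / 2"
    using uniform_limitD[OF assms(2), of "e / 2"] \<open>0 < e\<close> by simp
  thus "\<forall>\<^sub>F N in sequentially. \<forall>x\<in>{0..1}. dist (psum (\<lambda>m. c m / real (Suc m)) N x) (avg h x) < e"
  proof eventually_elim
    case (elim N)
    show ?case
    proof
      fix x :: real assume x: "x \<in> {0..1}"
      have "\<bar>avg (psum c N) x - avg h x\<bar> \<le> avg (\<lambda>_. e / 2) x"
        using elim by (intro avg_abs_diff_le cont01_psum assms(1) x continuous_on_const)
                      (auto simp: dist_real_def less_imp_le)
      thus "dist (psum (\<lambda>m. c m / real (Suc m)) N x) (avg h x) < e"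
        using \<open>0 < e\<close> by (simp add: dist_real_def avg_psum[OF x])
    qed
  qed
qed

text \<open>Half of \<open>e\<close> covers the error of the given series, which \<open>damp\<close>
  and \<open>avg\<close> do not enlarge; the other half covers the averaged boundary term, at most
  \<open>\<bar>?S\<bar> / (real N + 1)\<close> on all of [0, 1].\<close>

lemma uniform_limit_avg_damp:
  assumes "cont01 h" "uniform_limit {0..1} (psum c) h sequentially"
  shows "uniform_limit {0..1} (psum (\<lambda>m. (\<Sum>j\<le>m. c j) / real (Suc m))) (avg (damp h)) sequentially"
proof (rule uniform_limitI)
  fix e :: real assume "0 < e"
  let ?s = "\<lambda>m. \<Sum>j\<le>m. c j"
  have "\<forall>\<^sub>F N in sequentially. \<forall>x\<in>{0..1}. dist (psum c N x) (h x) < e / 2"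
    using uniform_limitD[OF assms(2), of "e / 2"] \<open>0 < e\<close> by simp
  moreover have "\<forall>\<^sub>F N in sequentially. \<bar>(\<Sum>j<N. c j) / (real N + 1)\<bar> < e / 2"
    using tendstoD[OF cesaro_null[OF uniform_limit_imp_coeff_null[OF assms(2)]], of "e / 2"] \<open>0 < e\<close>
    by (simp add: dist_real_def)
  ultimately show "\<forall>\<^sub>F N in sequentially. \<forall>x\<in>{0..1}.
    dist (psum (\<lambda>m. ?s m / real (Suc m)) N x) (avg (damp h) x) < e"
  proof eventually_elim
    case (elim N)
    let ?S = "\<Sum>j<N. c j"
    have bound: "\<bar>psum ?s N x - damp h x\<bar> \<le> e / 2 + \<bar>?S\<bar> * x ^ N" if x: "x \<in> {0..1}" for x
    proof -
      \<comment> \<open>This is \<open>psum_eq_partial_sums\<close> divided by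
        \<open>1 + x\<close>.\<close>
      have "damp (psum c N) x - psum ?s N x = (-1) ^ N * ?S * x ^ N / (1 + x)"
        using x unfolding damp_def psum_eq_partial_sums[of c N x] by (simp add: field_simps)
      hence "\<bar>damp (psum c N) x - psum ?s N x\<bar> = \<bar>?S\<bar> * x ^ N / (1 + x)"
        using x by (simp add: abs_mult power_abs)
      also have "\<dots> \<le> \<bar>?S\<bar> * x ^ N / 1"
        using x by (intro divide_left_mono mult_nonneg_nonneg) auto
      finally have "\<bar>damp (psum c N) x - psum ?s N x\<bar> \<le> \<bar>?S\<bar> * x ^ N"
        by simp
      moreover have "\<bar>damp (psum c N) x - damp h x\<bar> \<le> e / 2"
        using damp_abs_diff_le[OF x, of "psum c N" h] elim(1) x by (force simp: dist_real_def)
      ultimately show ?thesis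
        by linarith
    qed
    show ?case
    proof
      fix x :: real assume x: "x \<in> {0..1}"
      have "\<bar>avg (psum ?s N) x - avg (damp h) x\<bar> \<le> avg (\<lambda>x. e / 2 + \<bar>?S\<bar> * x ^ N) x"
        by (intro avg_abs_diff_le cont01_psum cont01_damp assms(1) bound x continuous_intros)
      also have "\<dots> = e / 2 + \<bar>?S\<bar> * x ^ N / (real N + 1)"
        using x by (subst avg_add) (auto intro!: continuous_intros simp: avg_mult_left avg_power)
      also have "\<bar>?S\<bar> * x ^ N / (real N + 1) \<le> \<bar>?S\<bar> * 1 / (real N + 1)"
        using x by (intro divide_right_mono mult_left_mono power_le_one) auto
      also have "\<dots> < e / 2"
        using elim(2) by simp
      finally show "dist (psum (\<lambda>m. ?s m / real (Suc m)) N x) (avg (damp h) x) < e"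
        by (simp add: dist_real_def avg_psum[OF x])
    qed
  qed
qed

text \<open>The first averaging is taken together with \<open>damp\<close>, hence the exponent
  \<open>Suc k\<close>; the remaining \<open>k\<close> follow one at a time.\<close>

lemma uniform_limit_step:
  assumes "cont01 h" "uniform_limit {0..1} (psum c) h sequentially"
  shows "uniform_limit {0..1} (psum (\<lambda>m. (\<Sum>j\<le>m. c j) / real (Suc m) ^ Suc k)) (step (Suc k) h) sequentially"
proof (induction k)
  case 0
  show ?case
    using uniform_limit_avg_damp[OF assms] by (simp add: step_def)
next
  case (Suc k)
  from uniform_limit_avg[OF cont01_step[OF assms(1)] this] show ?case
    by (simp add: step_def mult_ac)
qed

lemma uniform_limit_steps:
  assumes "\<forall>k\<in>set ks. 1 \<le> k"
  shows "uniform_limit {0..1} (psum (coeff ks)) (steps ks unit) sequentially"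
  using assms
proof (induction ks)
  case Nil
  \<comment> \<open>The coefficients 1, 0, 0, ... represent the constant \<open>unit\<close> exactly
    as soon as one term is included.\<close>
  have "psum (coeff []) N x = 1" if "N \<ge> 1" for N x
    using that by (induction N rule: dec_induct) (auto simp: psum_def)
  thus ?case
    by (intro uniform_limitI eventually_sequentiallyI[of 1]) (simp del: coeff.simps)
next
  case (Cons k ks)
  then obtain j where "k = Suc j"
    by (cases k) auto
  with Cons show ?case
    using uniform_limit_step[OF cont01_steps[OF cont01_unit], of "coeff ks" ks j] by simp
qed

section \<open>Sums over chains and their recursion\<close>

lemma chains_Suc_0: "1 \<le> m \<Longrightarrow> chains (Suc 0) m = {\<lambda>i\<in>{..<Suc 0}. m}"
  unfolding chains_def by (auto simp: PiE_iff extensional_def fun_eq_iff monotone_on_def)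

lemma finite_chains: "finite (chains r m)"
  unfolding chains_def by (rule finite_subset[of _ "{..<r} \<rightarrow>\<^sub>E {1..m}"]) (auto intro: finite_PiE)

text \<open>The sign is split off because it depends only on the first entry, which changes when the
  recursion passes to the tail.\<close>

definition chain_sum :: "(nat \<Rightarrow> nat) \<Rightarrow> nat \<Rightarrow> nat \<Rightarrow> real" where
  "chain_sum k r m = (\<Sum>n\<in>chains r m. 1 / (\<Prod>i<r. real (n i) ^ k i))"

text \<open>With \<open>tail_in_chains\<close>, this gives a bijection between chains starting at
  \<open>m\<close> and pairs of a second entry \<open>m'\<close> and a chain starting at
  \<open>m'\<close>.\<close>

lemma case_nat_in_chains:
  assumes "1 \<le> m'" "m' \<le> m" "n \<in> chains (Suc r) m'"
  shows "case_nat m n \<in> chains (Suc (Suc r)) m"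
proof -
  have n: "n i \<in> {1..m'}" if "i < Suc r" for i
    using assms(3) that by (auto simp: chains_def PiE_iff)
  have "case_nat m n i \<in> {1..m}" if "i < Suc (Suc r)" for i
    using n[of "i - 1"] that assms by (cases i) auto
  \<comment> \<open>Prepending shifts the index range by one, so the default value outside it is
    preserved.\<close>
  moreover have "case_nat m n i = undefined" if "\<not> i < Suc (Suc r)" for i
    using assms(3) that by (cases i) (auto simp: chains_def PiE_iff extensional_def)
  moreover have "case_nat m n j \<le> case_nat m n i" if "i \<le> j" "j < Suc (Suc r)" for i j
  proof (cases i)
    case 0
    thus ?thesis
      using n[of "j - 1"] that assms by (cases j) auto
  next
    case (Suc i')
    thus ?thesis
      using assms(3) that by (cases j) (auto simp: chains_def monotone_on_def)
  qed
  ultimately show ?thesis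
    unfolding chains_def by (auto simp: PiE_iff extensional_def monotone_on_def)
qed

lemma tail_in_chains:
  assumes "n \<in> chains (Suc (Suc r)) m"
  shows "n (Suc 0) \<in> {1..m}" "(\<lambda>i. n (Suc i)) \<in> chains (Suc r) (n (Suc 0))"
  using assms by (auto simp: chains_def PiE_iff extensional_def monotone_on_def)

text \<open>The first entry yields the factor \<open>1 / real m ^ k 0\<close>, and the tails are
  grouped by their first entry \<open>m'\<close>.\<close>

lemma chain_sum_Suc:
  assumes "1 \<le> m"
  shows "chain_sum k (Suc (Suc r)) m = (\<Sum>m'\<in>{1..m}. chain_sum (\<lambda>i. k (Suc i)) (Suc r) m') / real m ^ k 0"
proof -
  have "chain_sum k (Suc (Suc r)) m = (\<Sum>(m', n)\<in>(SIGMA m':{1..m}. chains (Suc r) m').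
      1 / (\<Prod>i<Suc r. real (n i) ^ k (Suc i)) / real m ^ k 0)"
    unfolding chain_sum_def
  proof (rule sum.reindex_bij_witness[where i = "\<lambda>(m', n). case_nat m n"
         and j = "\<lambda>n. (n (Suc 0), \<lambda>i. n (Suc i))"], goal_cases)
    case (1 n)
    thus ?case
      by (auto simp: chains_def fun_eq_iff split: nat.split)
  next
    case (2 n)
    thus ?case
      using tail_in_chains[OF 2] by auto
  next
    case (3 p)
    have "n 0 = m'" if "n \<in> chains (Suc r) m'" for n m'
      using that by (simp add: chains_def)
    with 3 show ?case
      by auto
  next
    case (4 p)
    thus ?case
      using case_nat_in_chains[of _ m] by auto
  next
    case (5 n)
    have "n 0 = m"
      using 5 by (simp add: chains_def)
    thus ?case
      unfolding prod.lessThan_Suc_shift[of _ "Suc r"] by (simp add: mult_ac)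
  qed
  also have "\<dots> = (\<Sum>m'\<in>{1..m}. \<Sum>n\<in>chains (Suc r) m'.
      1 / (\<Prod>i<Suc r. real (n i) ^ k (Suc i)) / real m ^ k 0)"
    by (subst sum.Sigma) (auto intro: finite_chains)
  finally show ?thesis
    by (simp add: chain_sum_def sum_divide_distrib)
qed

lemma prefix_Suc_eq_Cons: "prefix k (Suc r) = k 0 # prefix (\<lambda>i. k (Suc i)) r"
  unfolding prefix_def by (simp add: map_upt_Suc del: upt_Suc)

text \<open>Position \<open>m\<close> of \<open>coeff\<close> stands for n_1 = m + 1. The sequence
  \<open>k\<close> is generalized because the recursion drops its first entry.\<close>

lemma chain_sum_eq_coeff: "chain_sum k (Suc r) (Suc m) = coeff (prefix k (Suc r)) m"
proof (induction r arbitrary: k m)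
  case 0
  \<comment> \<open>These are the partial sums of \<open>coeff []\<close>, so that one entry
    \<open>a\<close> gives exactly the coefficients \<open>1 / real (Suc m) ^ a\<close>.\<close>
  have "(\<Sum>j\<le>m. if j = 0 then 1 else 0 :: real) = 1"
    by simp
  thus ?case
    by (simp add: chain_sum_def chains_Suc_0 prefix_Suc_eq_Cons)
next
  case (Suc r)
  have "(\<Sum>m'\<in>{1..Suc m}. chain_sum (\<lambda>i. k (Suc i)) (Suc r) m') =
        (\<Sum>j\<le>m. chain_sum (\<lambda>i. k (Suc i)) (Suc r) (Suc j))"
    using sum.shift_bounds_cl_Suc_ivl[of _ 0 m] by (simp add: atMost_atLeast0)
  thus ?case
    by (simp add: chain_sum_Suc Suc prefix_Suc_eq_Cons[of k "Suc r"])
qed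

section \<open>Convergence and evaluation of the multiple sums\<close>

lemma inner_sum_eq_coeff:
  "inner_sum k (Suc r) (Suc m) = (-1) ^ m * coeff (prefix k (Suc r)) m"
proof -
  have "inner_sum k (Suc r) (Suc m) = (-1) ^ m * chain_sum k (Suc r) (Suc m)"
    unfolding inner_sum_def chain_sum_def sum_distrib_left
    by (rule sum.cong) (auto simp: chains_def)
  thus ?thesis
    by (simp only: chain_sum_eq_coeff)
qed

lemma inner_sum_sums:
  assumes "k \<in> That"
  shows "(\<lambda>m. inner_sum k (Suc r) (Suc m)) sums steps (prefix k (Suc r)) unit 1"
proof -
  have "(\<lambda>N. psum (coeff (prefix k (Suc r))) N 1) \<longlonglongrightarrow> steps (prefix k (Suc r)) unit 1"
    using tendsto_uniform_limitI[OF uniform_limit_steps[OF prefix_pos[OF assms]], of 1] by simp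
  thus ?thesis
    by (simp add: sums_def psum_def inner_sum_eq_coeff)
qed

lemma multiple_sum_tendsto:
  assumes "k \<in> That"
  shows "multiple_sum k \<longlonglongrightarrow> val k"
proof -
  \<comment> \<open>At length 0 the entry \<open>n 0\<close> is \<open>undefined\<close>, so the
    comparison starts at length 1; the shift leaves the limit unchanged.\<close>
  have "multiple_sum k (Suc r) = steps (prefix k (Suc r)) unit 1" for r
    unfolding multiple_sum_def using inner_sum_sums[OF assms] by (rule sums_unique[symmetric])
  thus ?thesis
    using LIMSEQ_Suc[OF tendsto_val[OF assms]] by (subst filterlim_sequentially_Suc[symmetric]) simp
qed

theorem corollary1p3:
  shows "(\<forall>k\<in>That. (\<forall>r\<ge>1. summable (\<lambda>m. inner_sum k r (Suc m))) \<and> convergent (multiple_sum k))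
    \<and> bij_betw eta_minus_one That {1/2..<1}"
proof (intro conjI ballI allI impI)
  fix k r assume "k \<in> That" "1 \<le> (r :: nat)"
  thus "summable (\<lambda>m. inner_sum k r (Suc m))"
    using sums_summable[OF inner_sum_sums[of k "r - 1"]] by simp
next
  fix k assume "k \<in> That"
  thus "convergent (multiple_sum k)"
    using multiple_sum_tendsto convergentI by blast
next
  have "eta_minus_one k = val k" if "k \<in> That" for k
    unfolding eta_minus_one_def using multiple_sum_tendsto[OF that] by (rule limI)
  with bij_betw_val show "bij_betw eta_minus_one That {1/2..<1}"
    by (simp cong: bij_betw_cong)
qed

end
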